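(* The following is provable in TRC (equivalently, holds in every model $\mathcal D$ of TRC). None of the following 30 combinators exists; that is, for each item of the list there is no element $c\in\mathcal D$ which, put in place of the named combinator, satisfies the displayed equation for all values in $\mathcal D$ of the variables $x,y,z,w$ occurring in it: (1) $Bxyz=x(yz)$; (2) $Cxyz=xzy$; (3) $Dxyzw=xy(zw)$; (4) $Fxyz=zyx$; (5) $Gxyzw=xw(yz)$; (6) $Hxyz=xyzy$; (7) $H_1xy=xyx$; (8) $Jxyzw=xy(xwz)$; (9) $Kxy=x$; (10) $K_1xy=xx$; (11) $Lxy=x(yy)$; (12) $L_1xy=y(xx)$; (13) $Mx=xx$; (14) $M_1x=xxx$; (15) $M_2x=x(xx)$; (16) $Oxy=y(xy)$; (17) $O_1xy=x(yx)$; (18) $O_2xy=y(yx)$; (19) $Qxyz=y(xz)$; (20) $Q_1xyz=x(zy)$; (21) $Q_3xyz=z(xy)$; (22) $Rxyz=yzx$; (23) $Sxyz=xz(yz)$; (24) $Txy=yx$; (25) $Uxy=y(xxy)$; (26) $Vxyz=zxy$; (27) $Wxy=xyy$; (28) $W_1xy=yxx$; (29) $W_2xy=yxy$; (30) $W_3xy=yyx$.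
   Context: TRC is the first-order theory with equality whose language has a binary function "application", written $xy$ (with the convention $xyz=(xy)z$, i.e. application associates to the left), constants $Abst$, $Eq$, $p_1$, $p_2$, a unary function $k(x)$ and a binary function $\langle x,y\rangle$. The objects are called combinators. The axioms (universally quantified over all objects) are: I. $k(x)y=x$. II. $p_i\langle x_1,x_2\rangle=x_i$ for $i=1,2$. III. $\langle p_1x,p_2x\rangle=x$. IV. $\langle x,y\rangle z=\langle xz,yz\rangle$. V. $Abst\,x\,y\,z=x\,k(z)\,(yz)$. VI. $Eq\langle x,y\rangle=p_1$ if $x=y$; $Eq\langle x,y\rangle=p_2$ if $x\neq y$. VII. If $xz=yz$ for all $z$, then $x=y$. VIII. $p_1\neq p_2$. *)

theory Defs
  imports Main
begin

(* Models of the first-order theory TRC.  The carrier is the whole type 'a, so a statement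
   that is polymorphic in 'a quantifies over all models. *)
locale TRC =
  fixes app :: "'a \<Rightarrow> 'a \<Rightarrow> 'a"  (infixl "\<cdot>" 75)
    and Abst :: 'a
    and Eq :: 'a
    and p1 :: 'a
    and p2 :: 'a
    and k :: "'a \<Rightarrow> 'a"
    and pair :: "'a \<Rightarrow> 'a \<Rightarrow> 'a"  ("\<langle>_,/ _\<rangle>")
  assumes k_app: "k x \<cdot> y = x"
    and p1_pair: "p1 \<cdot> \<langle>x, y\<rangle> = x"
    and p2_pair: "p2 \<cdot> \<langle>x, y\<rangle> = y"
    and pair_proj: "\<langle>p1 \<cdot> x, p2 \<cdot> x\<rangle> = x"
    and pair_app: "\<langle>x, y\<rangle> \<cdot> z = \<langle>x \<cdot> z, y \<cdot> z\<rangle>"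
    and Abst_app: "Abst \<cdot> x \<cdot> y \<cdot> z = x \<cdot> k z \<cdot> (y \<cdot> z)"
    and Eq_eq: "x = y \<Longrightarrow> Eq \<cdot> \<langle>x, y\<rangle> = p1"
    and Eq_neq: "x \<noteq> y \<Longrightarrow> Eq \<cdot> \<langle>x, y\<rangle> = p2"
    and extensionality: "(\<And>z. x \<cdot> z = y \<cdot> z) \<Longrightarrow> x = y"
    and p1_neq_p2: "p1 \<noteq> p2"

end

theory Submission
  imports Defs
begin

text \<open>
  Application lowers the level of a function by one, \<open>k\<close> raises levels by one, and the axioms
  respect this stratification, whereas every listed equation puts some variable at two
  different levels, relative to its place among the arguments. The nonexistence proofs turn
  the mismatch into Cantor's diagonal argument.

  Inside a model, \<open>Abst \<cdot> k f \<cdot> g\<close> is composition, \<open>\<langle>p1, p2\<rangle>\<close> is the identity and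
  \<open>Eq\<close> decides equality, so for every \<open>e\<close> and \<open>v\<close> the model contains the two-valued function that
  returns \<open>p1\<close> exactly at those \<open>z\<close> with \<open>e \<cdot> z \<noteq> v\<close> (\<open>diagonal\<close>). Consequently no \<open>e\<close>
  can meet every \<open>A\<close>, in the sense that \<open>e \<cdot> z = A \<cdot> z\<close> for some \<open>z\<close>; nor can it do so after
  the values of \<open>A\<close> are passed through an injection such as \<open>k\<close> (\<open>no_universal_inj\<close>).

  The self-application combinator meets \<open>A\<close> at \<open>z = A\<close>. Some of the other listed
  combinators meet \<open>A\<close> at \<open>z = k A\<close>, or, for \<open>z (z z)\<close>, at a pair built from \<open>A\<close>. Others yield
  self-application or one of these functions once they are applied to fixed arguments or fed
  through \<open>Abst\<close>, which supplies the argument \<open>k z\<close> next to \<open>z\<close>. The remaining ones, again after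
  fixing arguments, either are an element for \<open>k\<close> or satisfy \<open>c \<cdot> x \<cdot> a = x\<close> for some \<open>a\<close>, which
  yields such an element (\<open>no_right_unit\<close>). That is impossible by \<open>no_internal_k\<close>: if \<open>k\<close> raised levels internally,
  the condition \<open>z \<cdot> z = p1\<close> could be expressed by quantifying over all \<open>y\<close> equal to \<open>z\<close>,
  and Russell's paradox would follow.
\<close>

context TRC
begin

section \<open>Composition and the diagonal function\<close>

definition I :: 'a where
  "I = \<langle>p1, p2\<rangle>"

definition comp :: "'a \<Rightarrow> 'a \<Rightarrow> 'a"  (infixr "\<bullet>" 70) where
  "f \<bullet> g = Abst \<cdot> k f \<cdot> g"

lemma I_app [simp]: "I \<cdot> x = x"
  by (simp add: I_def pair_app pair_proj)

lemma comp_app [simp]: "(f \<bullet> g) \<cdot> x = f \<cdot> (g \<cdot> x)"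
  by (simp add: comp_def Abst_app k_app)

lemmas [simp] = k_app p1_pair p2_pair pair_app Abst_app

lemma k_inject [simp]: "k x = k y \<longleftrightarrow> x = y"
  by (metis k_app)

lemma Eq_iff [simp]:
  "Eq \<cdot> \<langle>x, y\<rangle> = p1 \<longleftrightarrow> x = y"
  "Eq \<cdot> \<langle>x, y\<rangle> = p2 \<longleftrightarrow> x \<noteq> y"
  using Eq_eq Eq_neq p1_neq_p2 by metis+

lemma comp_k: "f \<bullet> k a = k (f \<cdot> a)"
  by (rule extensionality) simp

text \<open>
  Evaluating \<open>c \<cdot> x\<close> at the fixed \<open>a\<close> lowers its level, but the constant function with that
  value, which is \<open>(c \<cdot> x) \<bullet> k a\<close>, stays at the level of \<open>c \<cdot> x\<close>. Here the outer function
  of the composition varies, and \<open>Abst \<cdot> Abst\<close> supplies the \<open>k\<close> around it.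
\<close>
lemma evaluation_under_k:
  obtains e where "\<And>x. e \<cdot> x = k (c \<cdot> x \<cdot> a)"
proof
  fix x
  have "((Abst \<cdot> Abst \<cdot> k (k a)) \<bullet> c) \<cdot> x = (c \<cdot> x) \<bullet> k a"
    by (simp add: comp_def)
  then show "((Abst \<cdot> Abst \<cdot> k (k a)) \<bullet> c) \<cdot> x = k (c \<cdot> x \<cdot> a)"
    by (simp only: comp_k)
qed

text \<open>
  The outer test against \<open>p2\<close> is negation: \<open>Eq\<close> answers \<open>p2\<close> exactly when its
  arguments differ.
\<close>
lemma diagonal:
  obtains A where "\<And>z. A \<cdot> z = p1 \<longleftrightarrow> e \<cdot> z \<noteq> v"
proof
  fix z
  show "(Eq \<bullet> \<langle>Eq \<bullet> \<langle>e, k v\<rangle>, k p2\<rangle>) \<cdot> z = p1 \<longleftrightarrow> e \<cdot> z \<noteq> v"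
    by simp
qed

lemma no_universal_inj:
  assumes "inj i" and "\<And>A. \<exists>z. e \<cdot> z = i (A \<cdot> z)"
  shows False
proof -
  obtain A where A: "\<And>z. A \<cdot> z = p1 \<longleftrightarrow> e \<cdot> z \<noteq> i p1"
    using diagonal by blast
  obtain z where "e \<cdot> z = i (A \<cdot> z)"
    using assms(2) by blast
  then show False
    using A[of z] \<open>inj i\<close> by (auto simp: inj_eq)
qed

lemma no_universal:
  assumes "\<And>A. \<exists>z. e \<cdot> z = A \<cdot> z"
  shows False
  using assms no_universal_inj[of "\<lambda>x. x" e] by simp

lemma no_universal_k:
  assumes "\<And>A. \<exists>z. e \<cdot> z = k (A \<cdot> z)"
  shows False
  using assms no_universal_inj[of k e] by (simp add: inj_def)

section \<open>Forbidden functions\<close>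

lemma no_self_app:
  assumes "\<And>z. e \<cdot> z = z \<cdot> z"
  shows False
  using assms no_universal by blast

lemma no_k_self_app:
  assumes "\<And>z. e \<cdot> z = k (z \<cdot> z)"
  shows False
  using assms no_universal_k by blast

lemma no_self_app_at:
  assumes "\<And>z. c \<cdot> z \<cdot> a = z \<cdot> z"
  shows False
proof -
  obtain e where "\<And>x. e \<cdot> x = k (c \<cdot> x \<cdot> a)"
    using evaluation_under_k by blast
  then show False
    using no_k_self_app[of e] assms by simp
qed

text \<open>If \<open>z = k A\<close>, then \<open>z \<cdot> a \<cdot> z\<close> reduces to \<open>A \<cdot> z\<close>.\<close>
lemma no_app_self:
  assumes "\<And>z. e \<cdot> z = z \<cdot> a z \<cdot> z"
  shows False
proof (rule no_universal)
  fix A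
  show "\<exists>z. e \<cdot> z = A \<cdot> z"
    using assms[of "k A"] by auto
qed

lemma no_self_app_self_app:
  assumes "\<And>z. e \<cdot> z = z \<cdot> (z \<cdot> z)"
  shows False
proof (rule no_universal)
  fix A
  \<comment> \<open>The second component of \<open>z\<close> makes \<open>z \<cdot> z\<close> remember \<open>z\<close>, and the first applies \<open>A\<close> to it.\<close>
  let ?z = "\<langle>A \<bullet> p2, I\<rangle>"
  have "(p1 \<bullet> e) \<cdot> ?z = A \<cdot> ?z"
    by (simp add: assms)
  then show "\<exists>z. (p1 \<bullet> e) \<cdot> z = A \<cdot> z" ..
qed

text \<open>
  Given an element \<open>K\<close> for \<open>k\<close>, the function \<open>F\<close> below sends \<open>z\<close> to the function that is
  \<open>z \<cdot> z\<close> at \<open>z\<close> and \<open>p1\<close> everywhere else. So \<open>F \<cdot> z\<close> is the constant \<open>k p1\<close> exactly if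
  \<open>z \<cdot> z = p1\<close>, and the diagonal function for this test is Russell's.
\<close>
lemma no_internal_k:
  assumes K: "\<And>x. K \<cdot> x = k x"
  shows False
proof -
  define F where
    "F = Abst \<cdot> (Abst \<bullet> (Abst \<cdot> k Eq) \<bullet> \<langle>K, k I\<rangle>) \<cdot> \<langle>I, k (k p1)\<rangle>"
  \<comment> \<open>The truth value has to act on a pair, so the test compares \<open>k z\<close> and \<open>k y\<close>, one level up.\<close>
  have F: "F \<cdot> z \<cdot> y = Eq \<cdot> \<langle>k z, k y\<rangle> \<cdot> \<langle>z \<cdot> y, p1\<rangle>" for z y
    by (simp add: F_def K)
  have F_const: "F \<cdot> z = k p1 \<longleftrightarrow> z \<cdot> z = p1" for z
  proof
    assume "F \<cdot> z = k p1"
    then have "F \<cdot> z \<cdot> z = p1" by simp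
    then show "z \<cdot> z = p1" by (simp add: F Eq_eq del: pair_app)
  next
    assume "z \<cdot> z = p1"
    then have "F \<cdot> z \<cdot> y = k p1 \<cdot> y" for y
      by (cases "z = y") (simp_all add: F Eq_eq Eq_neq del: pair_app)
    then show "F \<cdot> z = k p1" by (rule extensionality)
  qed
  obtain A where "\<And>z. A \<cdot> z = p1 \<longleftrightarrow> F \<cdot> z \<noteq> k p1"
    using diagonal by blast
  then show False
    using F_const[of A] by blast
qed

lemma no_right_unit:
  assumes "\<And>x. c \<cdot> x \<cdot> a = x"
  shows False
proof -
  obtain e where "\<And>x. e \<cdot> x = k (c \<cdot> x \<cdot> a)"
    using evaluation_under_k by blast
  then show False
    using no_internal_k[of e] assms by simp
qed

text \<open>Evaluation at a point inverts \<open>k\<close>, so \<open>Abst\<close> can supply \<open>z\<close> also in function position.\<close>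
lemma no_evaluation:
  assumes "\<And>z. t \<cdot> z = z \<cdot> a"
  shows False
  using no_self_app[of "Abst \<cdot> t \<cdot> I"] assms by simp

section \<open>The thirty combinators\<close>

lemma no_M: "\<nexists>M. \<forall>x. M \<cdot> x = x \<cdot> x"
  using no_self_app by blast

lemma no_M1: "\<nexists>M1. \<forall>x. M1 \<cdot> x = x \<cdot> x \<cdot> x"
proof (rule notI, elim exE)
  fix M1
  assume "\<forall>x. M1 \<cdot> x = x \<cdot> x \<cdot> x"
  then show False
    using no_app_self[of M1 "\<lambda>z. z"] by simp
qed

lemma no_M2: "\<nexists>M2. \<forall>x. M2 \<cdot> x = x \<cdot> (x \<cdot> x)"
  using no_self_app_self_app by blast

lemma no_L: "\<nexists>L. \<forall>x y. L \<cdot> x \<cdot> y = x \<cdot> (y \<cdot> y)"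
proof (rule notI, elim exE)
  fix L
  assume "\<forall>x y. L \<cdot> x \<cdot> y = x \<cdot> (y \<cdot> y)"
  then show False
    using no_self_app[of "L \<cdot> I"] by simp
qed

lemma no_S: "\<nexists>S. \<forall>x y z. S \<cdot> x \<cdot> y \<cdot> z = x \<cdot> z \<cdot> (y \<cdot> z)"
proof (rule notI, elim exE)
  fix S
  assume "\<forall>x y z. S \<cdot> x \<cdot> y \<cdot> z = x \<cdot> z \<cdot> (y \<cdot> z)"
  then show False
    using no_self_app[of "S \<cdot> I \<cdot> I"] by simp
qed

lemma no_W: "\<nexists>W. \<forall>x y. W \<cdot> x \<cdot> y = x \<cdot> y \<cdot> y"
proof (rule notI, elim exE)
  fix W
  assume "\<forall>x y. W \<cdot> x \<cdot> y = x \<cdot> y \<cdot> y"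
  then show False
    using no_self_app[of "W \<cdot> I"] by simp
qed

text \<open>Since \<open>k z\<close> is constant, \<open>O' \<cdot> k z \<cdot> z\<close> is \<open>z \<cdot> z\<close>.\<close>
lemma no_O: "\<nexists>O'. \<forall>x y. O' \<cdot> x \<cdot> y = y \<cdot> (x \<cdot> y)"
proof (rule notI, elim exE)
  fix O'
  assume "\<forall>x y. O' \<cdot> x \<cdot> y = y \<cdot> (x \<cdot> y)"
  then show False
    using no_self_app[of "Abst \<cdot> O' \<cdot> I"] by simp
qed

text \<open>Since \<open>k z \<cdot> k z = z\<close>, \<open>U \<cdot> k z \<cdot> z\<close> is \<open>z \<cdot> (z \<cdot> z)\<close>.\<close>
lemma no_U: "\<nexists>U. \<forall>x y. U \<cdot> x \<cdot> y = y \<cdot> (x \<cdot> x \<cdot> y)"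
proof (rule notI, elim exE)
  fix U
  assume "\<forall>x y. U \<cdot> x \<cdot> y = y \<cdot> (x \<cdot> x \<cdot> y)"
  then show False
    using no_self_app_self_app[of "Abst \<cdot> U \<cdot> I"] by simp
qed

lemma no_O1: "\<nexists>O1. \<forall>x y. O1 \<cdot> x \<cdot> y = x \<cdot> (y \<cdot> x)"
proof (rule notI, elim exE)
  fix O1
  assume "\<forall>x y. O1 \<cdot> x \<cdot> y = x \<cdot> (y \<cdot> x)"
  then show False
    using no_self_app_at[of O1 I] by simp
qed

lemma no_L1: "\<nexists>L1. \<forall>x y. L1 \<cdot> x \<cdot> y = y \<cdot> (x \<cdot> x)"
proof (rule notI, elim exE)
  fix L1
  assume "\<forall>x y. L1 \<cdot> x \<cdot> y = y \<cdot> (x \<cdot> x)"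
  then show False
    using no_self_app_at[of L1 I] by simp
qed

lemma no_W1: "\<nexists>W1. \<forall>x y. W1 \<cdot> x \<cdot> y = y \<cdot> x \<cdot> x"
proof (rule notI, elim exE)
  fix W1
  assume "\<forall>x y. W1 \<cdot> x \<cdot> y = y \<cdot> x \<cdot> x"
  then show False
    using no_self_app_at[of W1 I] by simp
qed

lemma no_K1: "\<nexists>K1. \<forall>x y. K1 \<cdot> x \<cdot> y = x \<cdot> x"
proof (rule notI, elim exE)
  fix K1
  assume K1: "\<forall>x y. K1 \<cdot> x \<cdot> y = x \<cdot> x"
  have "K1 \<cdot> x = k (x \<cdot> x)" for x
    by (rule extensionality) (simp add: K1)
  then show False
    by (rule no_k_self_app)
qed

text \<open>
  At \<open>x = k A\<close> the value \<open>H1 \<cdot> x\<close> is the constant function \<open>k (A \<cdot> x)\<close>.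
\<close>
lemma no_H1: "\<nexists>H1. \<forall>x y. H1 \<cdot> x \<cdot> y = x \<cdot> y \<cdot> x"
proof (rule notI, elim exE)
  fix H1
  assume H1: "\<forall>x y. H1 \<cdot> x \<cdot> y = x \<cdot> y \<cdot> x"
  have "H1 \<cdot> k A = k (A \<cdot> k A)" for A
    by (rule extensionality) (simp add: H1)
  then show False
    using no_universal_k by blast
qed

lemma no_H: "\<nexists>H. \<forall>x y z. H \<cdot> x \<cdot> y \<cdot> z = x \<cdot> y \<cdot> z \<cdot> y"
proof (rule notI, elim exE)
  fix H
  assume "\<forall>x y z. H \<cdot> x \<cdot> y \<cdot> z = x \<cdot> y \<cdot> z \<cdot> y"
  then have "\<forall>x y. H \<cdot> I \<cdot> x \<cdot> y = x \<cdot> y \<cdot> x"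
    by simp
  then show False
    using no_H1 by blast
qed

lemma no_W2: "\<nexists>W2. \<forall>x y. W2 \<cdot> x \<cdot> y = y \<cdot> x \<cdot> y"
proof (rule notI, elim exE)
  fix W2
  assume "\<forall>x y. W2 \<cdot> x \<cdot> y = y \<cdot> x \<cdot> y"
  then show False
    using no_app_self[of "Abst \<cdot> W2 \<cdot> I" k] by simp
qed

text \<open>
  As third argument, \<open>k z\<close> absorbs one of the two before it and leaves \<open>z\<close> applied to the
  other, so \<open>z\<close> can follow as a fourth argument: \<open>V \<cdot> I \<cdot> I \<cdot> k z \<cdot> z = z \<cdot> I \<cdot> z\<close>. The same
  holds for \<open>F\<close> below.
\<close>
lemma no_V: "\<nexists>V. \<forall>x y z. V \<cdot> x \<cdot> y \<cdot> z = z \<cdot> x \<cdot> y"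
proof (rule notI, elim exE)
  fix V
  assume "\<forall>x y z. V \<cdot> x \<cdot> y \<cdot> z = z \<cdot> x \<cdot> y"
  then show False
    using no_app_self[of "Abst \<cdot> (V \<cdot> I \<cdot> I) \<cdot> I" "\<lambda>_. I"] by simp
qed

lemma no_F: "\<nexists>F. \<forall>x y z. F \<cdot> x \<cdot> y \<cdot> z = z \<cdot> y \<cdot> x"
proof (rule notI, elim exE)
  fix F
  assume "\<forall>x y z. F \<cdot> x \<cdot> y \<cdot> z = z \<cdot> y \<cdot> x"
  then show False
    using no_app_self[of "Abst \<cdot> (F \<cdot> I \<cdot> I) \<cdot> I" "\<lambda>_. I"] by simp
qed

text \<open>Here \<open>k z\<close> absorbs its own argument: \<open>R \<cdot> I \<cdot> k z \<cdot> z = k z \<cdot> z \<cdot> I = z \<cdot> I\<close>.\<close>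
lemma no_R: "\<nexists>R. \<forall>x y z. R \<cdot> x \<cdot> y \<cdot> z = y \<cdot> z \<cdot> x"
proof (rule notI, elim exE)
  fix R
  assume "\<forall>x y z. R \<cdot> x \<cdot> y \<cdot> z = y \<cdot> z \<cdot> x"
  then show False
    using no_evaluation[of "Abst \<cdot> (R \<cdot> I) \<cdot> I" I] by simp
qed

lemma no_K: "\<nexists>K. \<forall>x y. K \<cdot> x \<cdot> y = x"
  using no_internal_k by (metis extensionality k_app)

text \<open>
  With \<open>k I\<close> for \<open>x\<close> the last argument \<open>w\<close> is discarded, so \<open>G \<cdot> k I \<cdot> I\<close> would be an
  element for \<open>k\<close>.
\<close>
lemma no_G: "\<nexists>G. \<forall>x y z w. G \<cdot> x \<cdot> y \<cdot> z \<cdot> w = x \<cdot> w \<cdot> (y \<cdot> z)"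
proof (rule notI, elim exE)
  fix G
  assume G: "\<forall>x y z w. G \<cdot> x \<cdot> y \<cdot> z \<cdot> w = x \<cdot> w \<cdot> (y \<cdot> z)"
  have "G \<cdot> k I \<cdot> I \<cdot> z = k z" for z
    by (rule extensionality) (simp add: G)
  then show False
    by (rule no_internal_k)
qed

lemma no_B: "\<nexists>B. \<forall>x y z. B \<cdot> x \<cdot> y \<cdot> z = x \<cdot> (y \<cdot> z)"
proof (rule notI, elim exE)
  fix B
  assume B: "\<forall>x y z. B \<cdot> x \<cdot> y \<cdot> z = x \<cdot> (y \<cdot> z)"
  have "B \<cdot> x \<cdot> I = x" for x
    by (rule extensionality) (simp add: B)
  then show False
    by (rule no_right_unit)
qed

lemma no_D: "\<nexists>D. \<forall>x y z w. D \<cdot> x \<cdot> y \<cdot> z \<cdot> w = x \<cdot> y \<cdot> (z \<cdot> w)"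
proof (rule notI, elim exE)
  fix D
  assume "\<forall>x y z w. D \<cdot> x \<cdot> y \<cdot> z \<cdot> w = x \<cdot> y \<cdot> (z \<cdot> w)"
  then have "\<forall>x y z. D \<cdot> I \<cdot> x \<cdot> y \<cdot> z = x \<cdot> (y \<cdot> z)"
    by simp
  then show False
    using no_B by blast
qed

lemma no_Q: "\<nexists>Q. \<forall>x y z. Q \<cdot> x \<cdot> y \<cdot> z = y \<cdot> (x \<cdot> z)"
proof (rule notI, elim exE)
  fix Q
  assume Q: "\<forall>x y z. Q \<cdot> x \<cdot> y \<cdot> z = y \<cdot> (x \<cdot> z)"
  have "Q \<cdot> x \<cdot> I = x" for x
    by (rule extensionality) (simp add: Q)
  then show False
    by (rule no_right_unit)
qed

lemma no_O2: "\<nexists>O2. \<forall>x y. O2 \<cdot> x \<cdot> y = y \<cdot> (y \<cdot> x)"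
proof (rule notI, elim exE)
  fix O2
  assume "\<forall>x y. O2 \<cdot> x \<cdot> y = y \<cdot> (y \<cdot> x)"
  then show False
    using no_right_unit[of O2 I] by simp
qed

lemma no_W3: "\<nexists>W3. \<forall>x y. W3 \<cdot> x \<cdot> y = y \<cdot> y \<cdot> x"
proof (rule notI, elim exE)
  fix W3
  assume "\<forall>x y. W3 \<cdot> x \<cdot> y = y \<cdot> y \<cdot> x"
  then show False
    using no_right_unit[of W3 I] by simp
qed

lemma no_T: "\<nexists>T. \<forall>x y. T \<cdot> x \<cdot> y = y \<cdot> x"
proof (rule notI, elim exE)
  fix T
  assume "\<forall>x y. T \<cdot> x \<cdot> y = y \<cdot> x"
  then show False
    using no_right_unit[of T I] by simp
qed

lemma no_C: "\<nexists>C. \<forall>x y z. C \<cdot> x \<cdot> y \<cdot> z = x \<cdot> z \<cdot> y"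
proof (rule notI, elim exE)
  fix C
  assume "\<forall>x y z. C \<cdot> x \<cdot> y \<cdot> z = x \<cdot> z \<cdot> y"
  then have "\<forall>x y. C \<cdot> I \<cdot> x \<cdot> y = y \<cdot> x"
    by simp
  then show False
    using no_T by blast
qed

lemma no_J: "\<nexists>J. \<forall>x y z w. J \<cdot> x \<cdot> y \<cdot> z \<cdot> w = x \<cdot> y \<cdot> (x \<cdot> w \<cdot> z)"
proof (rule notI, elim exE)
  fix J
  assume "\<forall>x y z w. J \<cdot> x \<cdot> y \<cdot> z \<cdot> w = x \<cdot> y \<cdot> (x \<cdot> w \<cdot> z)"
  then have "\<forall>x y. J \<cdot> I \<cdot> I \<cdot> x \<cdot> y = y \<cdot> x"
    by simp
  then show False
    using no_T by blast
qed

lemma no_Q1: "\<nexists>Q1. \<forall>x y z. Q1 \<cdot> x \<cdot> y \<cdot> z = x \<cdot> (z \<cdot> y)"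
proof (rule notI, elim exE)
  fix Q1
  assume "\<forall>x y z. Q1 \<cdot> x \<cdot> y \<cdot> z = x \<cdot> (z \<cdot> y)"
  then have "\<forall>x y. Q1 \<cdot> I \<cdot> x \<cdot> y = y \<cdot> x"
    by simp
  then show False
    using no_T by blast
qed

lemma no_Q3: "\<nexists>Q3. \<forall>x y z. Q3 \<cdot> x \<cdot> y \<cdot> z = z \<cdot> (x \<cdot> y)"
proof (rule notI, elim exE)
  fix Q3
  assume "\<forall>x y z. Q3 \<cdot> x \<cdot> y \<cdot> z = z \<cdot> (x \<cdot> y)"
  then have "\<forall>x y. Q3 \<cdot> I \<cdot> x \<cdot> y = y \<cdot> x"
    by simp
  then show False
    using no_T by blast
qed

end

theorem mainTheorem1:
  fixes app :: "'a \<Rightarrow> 'a \<Rightarrow> 'a"  (infixl "\<cdot>" 75)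
    and Abst Eq p1 p2 :: 'a
    and k :: "'a \<Rightarrow> 'a"
    and pair :: "'a \<Rightarrow> 'a \<Rightarrow> 'a"
  assumes "TRC app Abst Eq p1 p2 k pair"
  shows "(\<nexists>B. \<forall>x y z. B \<cdot> x \<cdot> y \<cdot> z = x \<cdot> (y \<cdot> z)) \<and>
    (\<nexists>C. \<forall>x y z. C \<cdot> x \<cdot> y \<cdot> z = x \<cdot> z \<cdot> y) \<and>
    (\<nexists>D. \<forall>x y z w. D \<cdot> x \<cdot> y \<cdot> z \<cdot> w = x \<cdot> y \<cdot> (z \<cdot> w)) \<and>
    (\<nexists>F. \<forall>x y z. F \<cdot> x \<cdot> y \<cdot> z = z \<cdot> y \<cdot> x) \<and>
    (\<nexists>G. \<forall>x y z w. G \<cdot> x \<cdot> y \<cdot> z \<cdot> w = x \<cdot> w \<cdot> (y \<cdot> z)) \<and>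
    (\<nexists>H. \<forall>x y z. H \<cdot> x \<cdot> y \<cdot> z = x \<cdot> y \<cdot> z \<cdot> y) \<and>
    (\<nexists>H1. \<forall>x y. H1 \<cdot> x \<cdot> y = x \<cdot> y \<cdot> x) \<and>
    (\<nexists>J. \<forall>x y z w. J \<cdot> x \<cdot> y \<cdot> z \<cdot> w = x \<cdot> y \<cdot> (x \<cdot> w \<cdot> z)) \<and>
    (\<nexists>K. \<forall>x y. K \<cdot> x \<cdot> y = x) \<and>
    (\<nexists>K1. \<forall>x y. K1 \<cdot> x \<cdot> y = x \<cdot> x) \<and>
    (\<nexists>L. \<forall>x y. L \<cdot> x \<cdot> y = x \<cdot> (y \<cdot> y)) \<and>
    (\<nexists>L1. \<forall>x y. L1 \<cdot> x \<cdot> y = y \<cdot> (x \<cdot> x)) \<and>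
    (\<nexists>M. \<forall>x. M \<cdot> x = x \<cdot> x) \<and>
    (\<nexists>M1. \<forall>x. M1 \<cdot> x = x \<cdot> x \<cdot> x) \<and>
    (\<nexists>M2. \<forall>x. M2 \<cdot> x = x \<cdot> (x \<cdot> x)) \<and>
    (\<nexists>O'. \<forall>x y. O' \<cdot> x \<cdot> y = y \<cdot> (x \<cdot> y)) \<and>
    (\<nexists>O1. \<forall>x y. O1 \<cdot> x \<cdot> y = x \<cdot> (y \<cdot> x)) \<and>
    (\<nexists>O2. \<forall>x y. O2 \<cdot> x \<cdot> y = y \<cdot> (y \<cdot> x)) \<and>
    (\<nexists>Q. \<forall>x y z. Q \<cdot> x \<cdot> y \<cdot> z = y \<cdot> (x \<cdot> z)) \<and>
    (\<nexists>Q1. \<forall>x y z. Q1 \<cdot> x \<cdot> y \<cdot> z = x \<cdot> (z \<cdot> y)) \<and>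
    (\<nexists>Q3. \<forall>x y z. Q3 \<cdot> x \<cdot> y \<cdot> z = z \<cdot> (x \<cdot> y)) \<and>
    (\<nexists>R. \<forall>x y z. R \<cdot> x \<cdot> y \<cdot> z = y \<cdot> z \<cdot> x) \<and>
    (\<nexists>S. \<forall>x y z. S \<cdot> x \<cdot> y \<cdot> z = x \<cdot> z \<cdot> (y \<cdot> z)) \<and>
    (\<nexists>T. \<forall>x y. T \<cdot> x \<cdot> y = y \<cdot> x) \<and>
    (\<nexists>U. \<forall>x y. U \<cdot> x \<cdot> y = y \<cdot> (x \<cdot> x \<cdot> y)) \<and>
    (\<nexists>V. \<forall>x y z. V \<cdot> x \<cdot> y \<cdot> z = z \<cdot> x \<cdot> y) \<and>
    (\<nexists>W. \<forall>x y. W \<cdot> x \<cdot> y = x \<cdot> y \<cdot> y) \<and>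
    (\<nexists>W1. \<forall>x y. W1 \<cdot> x \<cdot> y = y \<cdot> x \<cdot> x) \<and>
    (\<nexists>W2. \<forall>x y. W2 \<cdot> x \<cdot> y = y \<cdot> x \<cdot> y) \<and>
    (\<nexists>W3. \<forall>x y. W3 \<cdot> x \<cdot> y = y \<cdot> y \<cdot> x)"
  by (intro conjI
      TRC.no_B[OF assms] TRC.no_C[OF assms] TRC.no_D[OF assms]
      TRC.no_F[OF assms] TRC.no_G[OF assms] TRC.no_H[OF assms]
      TRC.no_H1[OF assms] TRC.no_J[OF assms] TRC.no_K[OF assms]
      TRC.no_K1[OF assms] TRC.no_L[OF assms] TRC.no_L1[OF assms]
      TRC.no_M[OF assms] TRC.no_M1[OF assms] TRC.no_M2[OF assms]
      TRC.no_O[OF assms] TRC.no_O1[OF assms] TRC.no_O2[OF assms]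
      TRC.no_Q[OF assms] TRC.no_Q1[OF assms] TRC.no_Q3[OF assms]
      TRC.no_R[OF assms] TRC.no_S[OF assms] TRC.no_T[OF assms]
      TRC.no_U[OF assms] TRC.no_V[OF assms] TRC.no_W[OF assms]
      TRC.no_W1[OF assms] TRC.no_W2[OF assms] TRC.no_W3[OF assms])

end
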